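(* 1. If $p\ge 5$ is a prime, then $v_{(p+3)/2}\equiv -2p^3\pmod{p^4}$ and $v_{(p+3)/2}\equiv 2p^3(1-p)\,(p-1)!\,4^{p-1}\pmod{p^5}$. 2. Let $r\ge 1$ be an integer and $p\ge 2r+1$ a prime. Then $v_{\frac{p+3}{2}+rp}\equiv C_r\,p^{2r+2}\pmod{p^{2r+3}}$, where $$C_r=\frac{r}{(-4)^{r-1}}\Big(\frac{2r+1}{r!}\Big)^2\sum_{j=0}^{2r}b_{j,r}\,((1-2j))_{2r-1}.$$
   Context: For an integer $n\ge 1$ let $v_n=\Big[(1-x)\prod_{j=0}^{2n-3}(2n-3-j+jx)\Big]_{x^{n-1}}$, where $[f(x)]_{x^m}$ denotes the coefficient of $x^m$ in $f$. The integers $b_{j,r}$ are defined by $\prod_{a=1}^{2r}(2r+1-a+ax)=\sum_{j=0}^{2r}b_{j,r}x^j$, and for a number $u$ and integer $a\ge 1$, $((u))_a:=\prod_{j=1}^{a}(u+2j-2)$. The congruence in part 2 is understood in the sense that $C_r p^{2r+2}$ is a rational number whose denominator is prime to $p$. *)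

theory Defs
  imports "HOL-Computational_Algebra.Computational_Algebra" "HOL-Number_Theory.Cong"
begin

(* Intended for n >= 1. The j-range {..<2*n-2} is 0..2n-3, which is empty for n = 1;
   the coefficients 2n-3-j are computed in int, so nothing is truncated. *)
definition v_seq :: "nat \<Rightarrow> int" where
  "v_seq n =
     coeff ([:1, -1:] * (\<Prod>j<2*n-2. [:2 * int n - 3 - int j, int j:])) (n - 1)"

definition b_coeff :: "nat \<Rightarrow> nat \<Rightarrow> int" where
  "b_coeff j r = coeff (\<Prod>a=1..2*r. [:2 * int r + 1 - int a, int a:]) j"

definition double_poch :: "'a::comm_ring_1 \<Rightarrow> nat \<Rightarrow> 'a" where
  "double_poch u a = (\<Prod>j=1..a. u + 2 * of_nat j - 2)"

definition C_const :: "nat \<Rightarrow> rat" where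
  "C_const r = of_nat r / (-4) ^ (r - 1) * (of_nat (2*r+1) / fact r)\<^sup>2 *
     (\<Sum>j=0..2*r. of_int (b_coeff j r) * double_poch (1 - 2 * of_nat j) (2*r - 1))"

(* quotient_of gives the fraction in lowest terms with positive denominator. *)
definition p_integral :: "nat \<Rightarrow> rat \<Rightarrow> bool" where
  "p_integral p x \<longleftrightarrow> coprime (snd (quotient_of x)) (int p)"

(* x \<equiv> y (mod p^k) in the ring of rationals with denominator prime to p. *)
definition rat_cong_ppow :: "nat \<Rightarrow> nat \<Rightarrow> rat \<Rightarrow> rat \<Rightarrow> bool" where
  "rat_cong_ppow p k x y \<longleftrightarrow>
     p_integral p x \<and> p_integral p y \<and> p_integral p ((x - y) / of_nat p ^ k)"

end

theory Submission
  imports "HOL-Number_Theory.Residues" Defs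
begin

text \<open>
  Put \<open>N = 2 n - 3\<close>. The factors \<open>j = 0\<close> and \<open>j = N\<close> contribute \<open>N\<^sup>2 x\<close>, so \<open>v\<^sub>n\<close> is \<open>N\<^sup>2\<close> times the
  coefficient of \<open>x\<close> to the power \<open>(N - 1) / 2\<close> in \<open>(1 - x) * (\<Prod>0 < j < N. N - j + j x)\<close>.

  For \<open>N = p\<close>, pairing \<open>j\<close> with \<open>p - j\<close> gives factors \<open>j (p - j) (1 - x)\<^sup>2 + p\<^sup>2 x\<close>. As the sum of
  \<open>1 / j\<^sup>2\<close> over \<open>j < p / 2\<close> vanishes modulo \<open>p\<close>, the product is \<open>(p - 1)! (1 - x)\<close> to the power
  \<open>p - 1\<close> modulo \<open>p\<close> cubed. What remains is a binomial coefficient, evaluated by Morley's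
  congruence modulo \<open>p\<^sup>2\<close>; this comes from writing \<open>(p - 1)!\<close> both as \<open>\<Prod>i (p - i)\<close> and as
  \<open>\<Prod>2 i (p - 2 i)\<close> with \<open>i < p / 2\<close>, and from \<open>(p - 2 i)\<^sup>2 \<equiv> - 4 i (p - i)\<close> modulo \<open>p\<^sup>2\<close>.

  For \<open>N = (2 r + 1) p\<close>, the multiples of \<open>p\<close> among the \<open>j\<close> contribute the polynomial with
  coefficients \<open>b\<^sub>j\<^sub>,\<^sub>r\<close> and \<open>2 r\<close> factors \<open>p\<close>; modulo \<open>p\<close>, every other factor is a
  multiple of \<open>1 - x\<close>. The result is reduced with \<open>(1 - x) ^ p \<equiv> 1 - x ^ p\<close>, and the remaining
  binomial coefficients \<open>p - 2 r choose k\<close> with \<open>k = (p - 1) / 2 - j\<close> are congruent up to sign to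
  \<open>(\<Prod>i = 1..2 r - 1. k + i) / (2 r - 1)!\<close>, where \<open>2 (k + i) \<equiv> 2 i - 1 - 2 j\<close>.
\<close>

section \<open>Splitting products and sums over intervals\<close>

context comm_monoid_set
begin

text \<open>Pairs \<open>i\<close> with its mirror image \<open>2 * m + 1 - i\<close>. Working in a
  commutative monoid lets one splitting serve factorials, polynomial products and power sums
  alike.\<close>

lemma split_reflect:
  fixes m :: nat
  shows "F g {1..2 * m} = F (\<lambda>i. g i \<^bold>* g (2 * m + 1 - i)) {1..m}"
proof -
  have "F g {1..2 * m} = F g ({1..m} \<union> {m + 1..2 * m})"
    by (rule cong) auto
  also have "\<dots> = F g {1..m} \<^bold>* F g {m + 1..2 * m}"
    by (rule union_disjoint) auto
  also have "F g {m + 1..2 * m} = F (\<lambda>i. g (2 * m + 1 - i)) {1..m}"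
    by (rule reindex_bij_witness[where i = "\<lambda>i. 2 * m + 1 - i" and j = "\<lambda>i. 2 * m + 1 - i"]) auto
  finally show ?thesis
    by (simp add: distrib)
qed

text \<open>For an odd modulus \<open>p = 2 * m + 1\<close> the odd indices are the mirror images
  \<open>p - 2 * i\<close> of the even ones, so a second pairing by reflection arises, to be
  compared with the first.\<close>

lemma split_even_reflect:
  fixes m :: nat
  shows "F g {1..2 * m} = F (\<lambda>i. g (2 * i) \<^bold>* g (2 * m + 1 - 2 * i)) {1..m}"
proof -
  have "F g {1..2 * m} = F (\<lambda>i. g (2 * i) \<^bold>* g (2 * i - 1)) {1..m}"
  proof (induction m)
    case (Suc m)
    have "F g {1..2 * Suc m} = F g (insert (2 * m + 2) (insert (2 * m + 1) {1..2 * m}))"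
      by (rule cong) auto
    then show ?case
      using Suc by (simp add: ac_simps)
  qed simp
  also have "\<dots> = F (\<lambda>i. g (2 * i)) {1..m} \<^bold>* F (\<lambda>i. g (2 * i - 1)) {1..m}"
    by (rule distrib)
  also have "F (\<lambda>i. g (2 * i - 1)) {1..m} = F (\<lambda>i. g (2 * m + 1 - 2 * i)) {1..m}"
    by (rule reindex_bij_witness[where i = "\<lambda>i. m + 1 - i" and j = "\<lambda>i. m + 1 - i"])
      (auto simp: algebra_simps)
  finally show ?thesis
    by (simp add: distrib)
qed

lemma split_multiples:
  assumes "k > 0"
  shows "F g {1..<Suc s * k} = F (\<lambda>a. g (a * k)) {1..s} \<^bold>* F (\<lambda>a. F (\<lambda>i. g (a * k + i)) {1..<k}) {..s}"
proof (induction s)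
  case (Suc s)
  have "F g {1..<Suc (Suc s) * k} = F g ({1..<Suc s * k} \<union> insert (Suc s * k) {Suc s * k + 1..<Suc s * k + k})"
    using assms by (intro cong) auto
  also have "\<dots> = F g {1..<Suc s * k} \<^bold>* F g (insert (Suc s * k) {Suc s * k + 1..<Suc s * k + k})"
    by (rule union_disjoint) auto
  also have "F g (insert (Suc s * k) {Suc s * k + 1..<Suc s * k + k})
      = g (Suc s * k) \<^bold>* F g {Suc s * k + 1..<Suc s * k + k}"
    by (subst insert) auto
  also have "F g {Suc s * k + 1..<Suc s * k + k} = F (\<lambda>i. g (Suc s * k + i)) {1..<k}"
    by (rule reindex_bij_witness[where i = "\<lambda>i. Suc s * k + i" and j = "\<lambda>i. i - Suc s * k"]) auto
  finally show ?case
    unfolding Suc by (simp add: ac_simps)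
qed simp

end

section \<open>Congruences as divisibility, and coefficient formulas\<close>

lemma dvd_diff_trans:
  fixes d :: "'a::comm_ring_1"
  assumes "d dvd a - b" "d dvd b - c"
  shows "d dvd a - c"
  using dvd_add[OF assms] by simp

lemma dvd_diff_mult:
  fixes d :: "'a::comm_ring_1"
  assumes "d dvd a - b" "d dvd a' - b'"
  shows "d dvd a * a' - b * b'"
proof -
  have "a * a' - b * b' = (a - b) * a' + b * (a' - b')"
    by (simp add: algebra_simps)
  then show ?thesis
    using assms by simp
qed

lemma dvd_diff_prod:
  fixes d :: "'a::comm_ring_1"
  assumes "\<And>i. i \<in> A \<Longrightarrow> d dvd f i - g i"
  shows "d dvd prod f A - prod g A"
  using assms by (induction A rule: infinite_finite_induct) (simp_all add: dvd_diff_mult)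

lemma dvd_diff_power:
  fixes d :: "'a::comm_ring_1"
  assumes "d dvd a - b"
  shows "d dvd a ^ n - b ^ n"
  using dvd_diff_prod[of "{..<n}" d "\<lambda>_. a" "\<lambda>_. b"] assms by simp

text \<open>Every term of the expansion with at least two factors \<open>c\<close> is absorbed by
  \<open>c ^ 2\<close>. The cofactor products over \<open>A - {i}\<close> stand in for quotients by
  \<open>a i\<close>, which a general ring lacks.\<close>

lemma prod_add_first_order:
  fixes c :: "'a::comm_ring_1"
  assumes "finite A"
  shows "c ^ 2 dvd (\<Prod>i\<in>A. a i + c * b i) - ((\<Prod>i\<in>A. a i) + c * (\<Sum>i\<in>A. b i * (\<Prod>j\<in>A - {i}. a j)))"
  using assms
proof (induction A)
  case (insert x A)
  let ?P = "\<Prod>i\<in>A. a i" and ?S = "\<Sum>i\<in>A. b i * (\<Prod>j\<in>A - {i}. a j)"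
  obtain z where z: "(\<Prod>i\<in>A. a i + c * b i) = ?P + c * ?S + c ^ 2 * z"
    using insert.IH by (auto elim!: dvdE simp: algebra_simps)
  have "(\<Sum>i\<in>A. b i * (\<Prod>j\<in>insert x A - {i}. a j)) = (\<Sum>i\<in>A. a x * (b i * (\<Prod>j\<in>A - {i}. a j)))"
  proof (rule sum.cong)
    fix i assume "i \<in> A"
    then have "insert x A - {i} = insert x (A - {i})"
      using insert by auto
    then show "b i * (\<Prod>j\<in>insert x A - {i}. a j) = a x * (b i * (\<Prod>j\<in>A - {i}. a j))"
      using insert by simp
  qed simp
  then have "(\<Sum>i\<in>insert x A. b i * (\<Prod>j\<in>insert x A - {i}. a j)) = b x * ?P + a x * ?S"
    using insert by (simp add: sum_distrib_left)
  moreover have "(\<Prod>i\<in>insert x A. a i + c * b i) - (a x * ?P + c * (b x * ?P + a x * ?S))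
      = c ^ 2 * (b x * ?S + (a x + c * b x) * z)"
    using insert by (simp add: z power2_eq_square algebra_simps)
  ultimately show ?case
    using insert by simp
qed simp

text \<open>Congruence of integer polynomials modulo \<open>c\<close> is encoded as divisibility of
  the difference by the constant polynomial \<open>[:c:]\<close>; this lemma returns to
  integers.\<close>

lemma const_dvd_coeff: "[:c:] dvd f - g \<Longrightarrow> c dvd coeff f k - coeff g k" for f g :: "int poly"
  by (simp add: const_poly_dvd_iff)

lemma coeff_one_minus_x_power:
  "coeff ([:1, -1:] ^ n) k = (-1) ^ k * int (n choose k)"
proof (cases "k \<le> n")
  case False
  moreover have "degree ([:1, -1:] ^ n :: int poly) \<le> n"
    using degree_power_le[of "[:1, -1:] :: int poly" n] by simp
  ultimately show ?thesis
    by (simp add: binomial_eq_0 coeff_eq_0)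
qed (simp add: coeff_linear_poly_power)

lemma v_seq_odd:
  assumes "N = 2 * M + 1"
  shows "v_seq (M + 2) = int N ^ 2 * coeff ([:1, -1:] * (\<Prod>j=1..<N. [:int N - int j, int j:])) M"
proof -
  let ?f = "\<lambda>j. [:int N - int j, int j:]"
  have "{..<2 * (M + 2) - 2} = insert 0 (insert N {1..<N})"
    using assms by auto
  then have "(\<Prod>j<2 * (M + 2) - 2. ?f j) = ?f 0 * (?f N * (\<Prod>j=1..<N. ?f j))"
    using assms by simp
  then have "(\<Prod>j<2 * (M + 2) - 2. ?f j) = smult (int N ^ 2) (pCons 0 (\<Prod>j=1..<N. ?f j))"
    by (simp add: power2_eq_square)
  moreover have "2 * int (M + 2) - 3 = int N"
    using assms by simp
  ultimately show ?thesis
    unfolding v_seq_def by (simp only: mult_smult_right coeff_smult mult_pCons_right) simp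
qed

lemma coprime_prime_int:
  assumes "prime p" "\<not> p dvd a"
  shows "coprime (int a) (int p)"
  using assms by (metis coprime_commute coprime_int_iff prime_imp_coprime_nat)

lemma fermat_theorem_int:
  assumes "prime p" "\<not> p dvd a"
  shows "[int a ^ (p - 1) = 1] (mod int p)"
  using fermat_theorem[OF assms] by (metis cong_int_iff of_nat_1 of_nat_power)

section \<open>Binomial coefficients modulo powers of an odd prime\<close>

context
  fixes p m :: nat
  assumes prime: "prime p" and p_eq: "p = 2 * m + 1"
begin

lemma not_dvd_below: "0 < i \<Longrightarrow> i < p \<Longrightarrow> \<not> p dvd i"
  by (auto dest: dvd_imp_le)

lemma fact_eq_prod_reflect: "fact (2 * m) = (\<Prod>i=1..m. int i * (int p - int i))"
proof -
  have "fact (2 * m) = (\<Prod>i=1..m. int i * int (2 * m + 1 - i))"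
    by (simp only: fact_prod of_nat_prod of_nat_mult prod.split_reflect of_nat_id)
  also have "\<dots> = (\<Prod>i=1..m. int i * (int p - int i))"
    by (rule prod.cong) (auto simp: p_eq of_nat_diff)
  finally show ?thesis .
qed

lemma fact_eq_prod_even_reflect: "fact (2 * m) = (\<Prod>i=1..m. 2 * int i * (int p - 2 * int i))"
proof -
  have "fact (2 * m) = (\<Prod>i=1..m. int (2 * i) * int (2 * m + 1 - 2 * i))"
    by (simp only: fact_prod of_nat_prod of_nat_mult prod.split_even_reflect of_nat_id)
  also have "\<dots> = (\<Prod>i=1..m. 2 * int i * (int p - 2 * int i))"
    by (rule prod.cong) (auto simp: p_eq of_nat_diff)
  finally show ?thesis .
qed

lemma central_binomial_cong: "[int (2 * m choose m) = (-1) ^ m * 4 ^ (2 * m)] (mod int p ^ 2)"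
proof -
  let ?c = "int (2 * m choose m)" and ?f = "fact m :: int"
  have fact: "?f = (\<Prod>i=1..m. int i)"
    by (simp add: fact_prod of_nat_prod)
  have "fact m * fact m * (2 * m choose m) = (fact (2 * m) :: nat)"
    using binomial_fact_lemma[of m "2 * m"] by simp
  then have c: "?f * ?f * ?c = fact (2 * m)"
    by (metis of_nat_fact of_nat_mult)
  \<comment> \<open>Each factorization of \<open>(2 * m)!\<close> contains \<open>m!\<close> once as
    a visible factor. Cancelling it gives two product formulas for \<open>?f * ?c\<close>.\<close>
  have "?f * (?f * ?c) = ?f * (\<Prod>i=1..m. int p - int i)"
    unfolding c[unfolded mult.assoc] fact_eq_prod_reflect prod.distrib by (simp only: fact)
  then have c1: "?f * ?c = (\<Prod>i=1..m. int p - int i)"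
    by (simp only: mult_left_cancel fact_nonzero not_False_eq_True)
  have "?f * (?f * ?c) = ?f * (2 ^ m * (\<Prod>i=1..m. int p - 2 * int i))"
    unfolding c[unfolded mult.assoc] fact_eq_prod_even_reflect prod.distrib
    by (simp only: fact prod_constant card_atLeastAtMost diff_Suc_1 ac_simps)
  then have c2: "?f * ?c = 2 ^ m * (\<Prod>i=1..m. int p - 2 * int i)"
    by (simp only: mult_left_cancel fact_nonzero not_False_eq_True)
  have cop: "coprime (?f * ?f * ?c) (int p ^ 2)"
  proof -
    have "\<not> p dvd fact (2 * m)"
      using prime p_eq by (simp add: prime_dvd_fact_iff)
    from coprime_prime_int[OF prime this] show ?thesis
      by (simp add: c)
  qed
  have "[(\<Prod>i=1..m. (int p - 2 * int i) ^ 2) = (\<Prod>i=1..m. (-4) * (int i * (int p - int i)))] (mod int p ^ 2)"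
  proof (rule cong_prod)
    fix i
    have "(int p - 2 * int i) ^ 2 - (-4) * (int i * (int p - int i)) = int p ^ 2"
      by (simp add: power2_eq_square algebra_simps)
    then show "[(int p - 2 * int i) ^ 2 = (-4) * (int i * (int p - int i))] (mod int p ^ 2)"
      by (simp add: cong_iff_dvd_diff)
  qed
  also have "(\<Prod>i=1..m. (-4) * (int i * (int p - int i))) = (-4) ^ m * (?f * (?f * ?c))"
    by (simp only: prod.distrib fact[symmetric] c1) simp
  \<comment> \<open>The factor \<open>4 ^ m\<close> turns the left side into the square of
    \<open>?f * ?c\<close>. Both sides then contain \<open>?f * ?f * ?c = (2 * m)!\<close>, which is
    coprime to \<open>p\<close> and is cancelled.\<close>
  finally have "[4 ^ m * (\<Prod>i=1..m. (int p - 2 * int i) ^ 2) = 4 ^ m * ((-4) ^ m * (?f * (?f * ?c)))] (mod int p ^ 2)"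
    by (rule cong_scalar_left)
  moreover have "4 ^ m * (\<Prod>i=1..m. (int p - 2 * int i) ^ 2) = (?f * ?f * ?c) * ?c"
  proof -
    have "(?f * ?f * ?c) * ?c = (?f * ?c) * (?f * ?c)"
      by (simp add: algebra_simps)
    also have "\<dots> = (2 * 2) ^ m * (\<Prod>i=1..m. (int p - 2 * int i) ^ 2)"
      unfolding c2 power_mult_distrib by (simp add: power2_eq_square prod.distrib ac_simps)
    finally show ?thesis
      by simp
  qed
  moreover have "4 ^ m * ((-4) ^ m * (?f * (?f * ?c))) = (?f * ?f * ?c) * ((-1) ^ m * 4 ^ (2 * m))"
  proof -
    have "(-4) ^ m = (-1) ^ m * (4 ^ m :: int)"
      by (simp flip: power_mult_distrib)
    moreover have "4 ^ (2 * m) = 4 ^ m * (4 ^ m :: int)"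
      by (simp add: mult_2 power_add)
    ultimately show ?thesis
      by (simp only: ac_simps)
  qed
  ultimately show ?thesis
    by (metis cong_mult_lcancel cop)
qed

text \<open>Absorption gives (p + 1) (p choose m) = 2 p (2m choose m). Modulo p^2 the inverse of p +
  1 is 1 - p, and the factor p lifts the central binomial congruence from p^2 to p^3.\<close>

lemma binomial_half_cong:
  "[(-1) ^ m * int (p choose m) = 2 * int p * (1 - int p) * 4 ^ (p - 1)] (mod int p ^ 3)"
proof -
  let ?c = "int (2 * m choose m)"
  have "(m + 1) * (Suc (2 * m) choose m) = Suc (2 * m) * (2 * m choose m)"
    using binomial_absorb_comp[of "Suc (2 * m)" m] by simp
  then have "(int m + 1) * int (p choose m) = int p * ?c"
    unfolding p_eq by (metis Suc_eq_plus1 of_nat_Suc of_nat_mult add.commute)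
  then have "2 * ((int m + 1) * int (p choose m)) = 2 * (int p * ?c)"
    by simp
  then have 1: "(int p + 1) * int (p choose m) = 2 * int p * ?c"
    by (simp add: p_eq algebra_simps)
  have "int p ^ 2 dvd (-1) ^ m * (?c - (-1) ^ m * 4 ^ (p - 1))"
    using central_binomial_cong p_eq by (simp add: cong_iff_dvd_diff)
  then have "int p ^ 2 dvd (-1) ^ m * ?c - 4 ^ (p - 1)"
    by (simp add: right_diff_distrib flip: power_mult_distrib mult.assoc)
  then obtain z where "(-1) ^ m * ?c - 4 ^ (p - 1) = int p ^ 2 * z"
    by (rule dvdE)
  then have z: "(-1) ^ m * ?c = 4 ^ (p - 1) + int p ^ 2 * z"
    by (simp only: diff_eq_eq add.commute)
  have "(int p + 1) * ((-1) ^ m * int (p choose m)) = (-1) ^ m * ((int p + 1) * int (p choose m))"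
    by (simp add: algebra_simps)
  also have "\<dots> = 2 * int p * ((-1) ^ m * ?c)"
    unfolding 1 by (simp add: algebra_simps)
  also have "\<dots> = (int p + 1) * (2 * int p * (1 - int p) * 4 ^ (p - 1)) + int p ^ 3 * (2 * z + 2 * 4 ^ (p - 1))"
    unfolding z by (simp add: power2_eq_square power3_eq_cube algebra_simps)
  finally have "[(int p + 1) * ((-1) ^ m * int (p choose m))
      = (int p + 1) * (2 * int p * (1 - int p) * 4 ^ (p - 1))] (mod int p ^ 3)"
    by (simp add: cong_iff_dvd_diff)
  moreover have "coprime (int p + 1) (int p ^ 3)"
    by simp
  ultimately show ?thesis
    by (simp only: cong_mult_lcancel)
qed

section \<open>The case \<open>N = p\<close>: the product modulo p^3\<close>

context
  assumes m_ge: "m \<ge> 2"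
begin

lemma p_minus_1: "p - 1 = 2 + 2 * (m - 1)"
  using m_ge p_eq by simp

text \<open>The exponent is p - 3, so by Fermat this is the sum of the inverse squares. The two
  pairings evaluate the full sum \<open>?T\<close> as 2 S and as 2^(p-2) S modulo p, with S the half
  sum.\<close>

lemma half_power_sum: "int p dvd (\<Sum>i=1..m. int i ^ (2 * (m - 1)))"
proof -
  let ?f = "\<lambda>i::int. i ^ (2 * (m - 1))"
  let ?S = "\<Sum>i=1..m. ?f (int i)" and ?T = "\<Sum>i=1..2 * m. ?f (int i)"
  have reflect: "[?f (int (2 * m + 1 - i)) = ?f (int i)] (mod int p)" if "i \<le> 2 * m" for i
  proof -
    have "int (2 * m + 1 - i) = int p - int i"
      using that by (simp add: p_eq of_nat_diff)
    moreover have "[int p - int i = - int i] (mod int p)"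
      by (simp add: cong_iff_dvd_diff)
    ultimately have "[?f (int (2 * m + 1 - i)) = ?f (- int i)] (mod int p)"
      using cong_pow by metis
    then show ?thesis
      by simp
  qed
  have "[?T = (\<Sum>i=1..m. ?f (int i) + ?f (int i))] (mod int p)"
    unfolding sum.split_reflect by (intro cong_sum cong_add cong_refl reflect) auto
  then have 1: "[?T = 2 * ?S] (mod int p)"
    by (simp flip: sum_distrib_left mult_2)
  have "[?T = (\<Sum>i=1..m. ?f (int (2 * i)) + ?f (int (2 * i)))] (mod int p)"
    unfolding sum.split_even_reflect by (intro cong_sum cong_add cong_refl reflect) auto
  also have "(\<Sum>i=1..m. ?f (int (2 * i)) + ?f (int (2 * i))) = 2 * 2 ^ (2 * (m - 1)) * ?S"
    by (simp add: power_mult_distrib sum_distrib_left mult.assoc flip: mult_2)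
  finally have "[2 * ?S = 2 * 2 ^ (2 * (m - 1)) * ?S] (mod int p)"
    using cong_trans[OF cong_sym[OF 1]] by blast
  \<comment> \<open>Multiplying by 4 completes the power of 2 to \<open>2 ^ (p - 1)\<close>, so 8 S
    is congruent to 2 S. The resulting factor 6 is invertible because p is at least 5.\<close>
  then have "[4 * (2 * ?S) = 4 * (2 * 2 ^ (2 * (m - 1)) * ?S)] (mod int p)"
    by (rule cong_scalar_left)
  also have "4 * (2 * 2 ^ (2 * (m - 1)) * ?S) = 2 ^ (p - 1) * (2 * ?S)"
    by (simp only: p_minus_1 power_add) simp
  also have "[2 ^ (p - 1) * (2 * ?S) = 1 * (2 * ?S)] (mod int p)"
    using fermat_theorem_int[OF prime, of 2] m_ge p_eq not_dvd_below[of 2]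
    by (intro cong_scalar_right) auto
  finally have "int p dvd 6 * ?S"
    by (simp add: cong_iff_dvd_diff)
  moreover have "\<not> p dvd 6"
  proof
    assume "p dvd 6"
    then have "p dvd 2 \<or> p dvd 3"
      using prime_dvd_mult_iff[OF prime, of 2 3] by simp
    then show False
      using m_ge p_eq not_dvd_below[of 2] not_dvd_below[of 3] by auto
  qed
  then have "coprime 6 (int p)"
    using coprime_prime_int[OF prime, of 6] by simp
  ultimately show ?thesis
    by (simp add: coprime_commute coprime_dvd_mult_right_iff)
qed

text \<open>The cofactor is (p - 1)! divided by j (p - j), that is -1 divided by -j^2 by Wilson;
  Fermat writes the inverse square as j^(p-3).\<close>

lemma reflect_cofactor_cong:
  assumes "j \<in> {1..m}"
  shows "[(\<Prod>i\<in>{1..m} - {j}. int i * (int p - int i)) = int j ^ (2 * (m - 1))] (mod int p)"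
proof -
  let ?Q = "\<Prod>i\<in>{1..m} - {j}. int i * (int p - int i)"
  have "int j * (int p - int j) * ?Q = fact (2 * m)"
    using prod.remove[of "{1..m}" j "\<lambda>i. int i * (int p - int i)"] assms
    by (simp only: fact_eq_prod_reflect finite_atLeastAtMost)
  moreover have "[fact (2 * m) = - 1] (mod int p)"
    using wilson_theorem[OF prime] p_eq by simp
  ultimately have "int p dvd int j * (int p - int j) * ?Q + 1"
    by (simp add: cong_iff_dvd_diff)
  \<comment> \<open>Subtracting from this multiple of \<open>p\<close> replaces \<open>p - j\<close>
    by \<open>- j\<close> and leaves \<open>int j ^ 2 * ?Q - 1\<close>.\<close>
  then have "int p dvd int j * ?Q * int p - (int j * (int p - int j) * ?Q + 1)"
    by (intro dvd_diff) auto
  then have "int p dvd int j ^ 2 * ?Q - 1"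
    by (simp add: algebra_simps power2_eq_square)
  then have "[int j ^ 2 * ?Q = 1] (mod int p)"
    by (simp add: cong_iff_dvd_diff)
  also have "[1 = int j ^ (p - 1)] (mod int p)"
    using fermat_theorem_int[OF prime, of j] not_dvd_below[of j] assms p_eq by (auto simp: cong_sym_eq)
  also have "int j ^ (p - 1) = int j ^ 2 * int j ^ (2 * (m - 1))"
    by (simp only: p_minus_1 power_add)
  finally have "[int j ^ 2 * ?Q = int j ^ 2 * int j ^ (2 * (m - 1))] (mod int p)" .
  moreover have "coprime (int j ^ 2) (int p)"
    using coprime_prime_int[OF prime not_dvd_below] assms p_eq by simp
  ultimately show ?thesis
    by (simp only: cong_mult_lcancel)
qed

text \<open>First-order expansion in \<open>c\<close> = p^2: the error is divisible by p^4, and the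
  linear coefficient \<open>S\<close> is a sum of cofactors, hence divisible by p.\<close>

lemma linear_product_cong_cube:
  "[:int p ^ 3:] dvd (\<Prod>j=1..<p. [:int p - int j, int j:]) - smult (fact (p - 1)) ([:1, -1:] ^ (p - 1))"
proof -
  define t :: "int poly" where "t = [:1, -1:]"
  define a where "a = (\<lambda>i. int i * (int p - int i))"
  define S where "S = (\<Sum>i=1..m. \<Prod>j\<in>{1..m} - {i}. a j)"
  have "(\<Prod>j=1..<p. [:int p - int j, int j:]) = (\<Prod>j=1..2 * m. [:int p - int j, int j:])"
    by (rule prod.cong) (auto simp: p_eq)
  also have "\<dots> = (\<Prod>j=1..m. smult (a j) (t ^ 2) + [:int p ^ 2:] * [:0, 1:])"
    unfolding prod.split_reflect
    by (rule prod.cong) (auto simp: p_eq of_nat_diff a_def t_def power2_eq_square algebra_simps)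
  finally have prod: "(\<Prod>j=1..<p. [:int p - int j, int j:])
      = (\<Prod>j=1..m. smult (a j) (t ^ 2) + [:int p ^ 2:] * [:0, 1:])" .
  have "(\<Prod>j=1..m. smult (a j) (t ^ 2)) = smult (fact (p - 1)) (t ^ (p - 1))"
    by (simp add: prod_smult p_eq fact_eq_prod_reflect a_def power_mult)
  moreover have "(\<Sum>i=1..m. [:0, 1:] * (\<Prod>j\<in>{1..m} - {i}. smult (a j) (t ^ 2)))
      = smult S ([:0, 1:] * (t ^ 2) ^ (m - 1))"
    by (simp only: prod_smult S_def smult_sum mult_smult_right sum_distrib_left prod_constant)
      (simp add: card_Diff_singleton)
  moreover have "[:int p ^ 2:] ^ 2 = [:int p ^ 4:]"
    by (simp add: poly_const_pow flip: power_mult)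
  ultimately have "[:int p ^ 4:] dvd (\<Prod>j=1..<p. [:int p - int j, int j:])
      - (smult (fact (p - 1)) (t ^ (p - 1)) + [:int p ^ 2:] * smult S ([:0, 1:] * (t ^ 2) ^ (m - 1)))"
    using prod_add_first_order[of "{1..m}" "[:int p ^ 2:]" "\<lambda>i. smult (a i) (t ^ 2)" "\<lambda>_. [:0, 1:]"]
    unfolding prod by simp
  moreover have "[:int p ^ 3:] dvd [:int p ^ 4:]"
    by (simp add: const_poly_dvd_const_poly_iff le_imp_power_dvd)
  ultimately have "[:int p ^ 3:] dvd (\<Prod>j=1..<p. [:int p - int j, int j:])
      - (smult (fact (p - 1)) (t ^ (p - 1)) + [:int p ^ 2:] * smult S ([:0, 1:] * (t ^ 2) ^ (m - 1)))"
    by (rule dvd_trans[rotated])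
  then show ?thesis
    unfolding t_def[symmetric]
  proof (rule dvd_diff_trans)
    have "[S = (\<Sum>i=1..m. int i ^ (2 * (m - 1)))] (mod int p)"
      unfolding S_def a_def by (intro cong_sum reflect_cofactor_cong)
    then have "int p dvd S"
      using half_power_sum cong_dvd_iff by blast
    then have "[:int p ^ 3:] dvd [:int p ^ 2 * S:]"
      by (auto simp: power3_eq_cube power2_eq_square)
    then have "[:int p ^ 3:] dvd [:int p ^ 2 * S:] * ([:0, 1:] * (t ^ 2) ^ (m - 1))"
      by (rule dvd_mult2)
    then show "[:int p ^ 3:] dvd smult (fact (p - 1)) (t ^ (p - 1))
        + [:int p ^ 2:] * smult S ([:0, 1:] * (t ^ 2) ^ (m - 1)) - smult (fact (p - 1)) (t ^ (p - 1))"
      by (simp add: mult.commute)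
  qed
qed

text \<open>The extra factor 1 - x raises the exponent p - 1 to p, which produces
  \<open>p choose m\<close>; the factor \<open>N ^ 2\<close> lifts the modulus from p^3 to
  p^5.\<close>

lemma v_seq_half_prime:
  "[v_seq (m + 2) = 2 * int p ^ 3 * (1 - int p) * fact (p - 1) * 4 ^ (p - 1)] (mod int p ^ 5)"
proof -
  let ?P = "\<Prod>j=1..<p. [:int p - int j, int j:]"
  have "[:int p ^ 3:] dvd [:1, -1:] * ?P - [:1, -1:] * smult (fact (p - 1)) ([:1, -1:] ^ (p - 1))"
    using linear_product_cong_cube by (intro dvd_diff_mult) simp_all
  from const_dvd_coeff[OF this, of m]
  have "[coeff ([:1, -1:] * ?P) m
      = coeff ([:1, -1:] * smult (fact (p - 1)) ([:1, -1:] ^ (p - 1))) m] (mod int p ^ 3)"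
    by (simp add: cong_iff_dvd_diff)
  also have "coeff ([:1, -1:] * smult (fact (p - 1)) ([:1, -1:] ^ (p - 1))) m
      = fact (p - 1) * coeff ([:1, -1:] ^ Suc (p - 1)) m"
    by (simp only: mult_smult_right coeff_smult power_Suc)
  also have "\<dots> = fact (p - 1) * ((-1) ^ m * int (p choose m))"
    using p_eq by (simp only: coeff_one_minus_x_power) simp
  also have "[\<dots> = fact (p - 1) * (2 * int p * (1 - int p) * 4 ^ (p - 1))] (mod int p ^ 3)"
    using binomial_half_cong by (rule cong_scalar_left)
  finally have "int p ^ 2 * int p ^ 3 dvd int p ^ 2 *
      (coeff ([:1, -1:] * ?P) m - fact (p - 1) * (2 * int p * (1 - int p) * 4 ^ (p - 1)))"
    unfolding cong_iff_dvd_diff by (intro mult_dvd_mono dvd_refl)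
  moreover have "int p ^ 2 * int p ^ 3 = int p ^ 5"
    by (simp flip: power_add)
  moreover have "int p ^ 2 * (x - fact (p - 1) * (2 * int p * (1 - int p) * 4 ^ (p - 1)))
      = int p ^ 2 * x - 2 * int p ^ 3 * (1 - int p) * fact (p - 1) * 4 ^ (p - 1)" for x
    by (simp add: algebra_simps power2_eq_square power3_eq_cube)
  ultimately show ?thesis
    unfolding v_seq_odd[OF p_eq] cong_iff_dvd_diff by simp
qed

lemma v_seq_half_prime_leading: "[v_seq (m + 2) = - 2 * int p ^ 3] (mod int p ^ 4)"
proof -
  have "[(1 - int p) * fact (p - 1) * 4 ^ (p - 1) = 1 * (- 1) * 1] (mod int p)"
  proof (intro cong_mult)
    show "[1 - int p = 1] (mod int p)"
      by (simp add: cong_iff_dvd_diff)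
    show "[fact (p - 1) = - 1] (mod int p)"
      by (rule wilson_theorem[OF prime])
    show "[4 ^ (p - 1) = 1] (mod int p)"
      using fermat_theorem_int[OF prime, of 4] not_dvd_below[of 4] m_ge p_eq by simp
  qed
  then have "int p ^ 3 * int p dvd int p ^ 3 * (2 * ((1 - int p) * fact (p - 1) * 4 ^ (p - 1) + 1))"
    by (intro mult_dvd_mono dvd_mult) (simp_all add: cong_iff_dvd_diff)
  then have "[2 * int p ^ 3 * (1 - int p) * fact (p - 1) * 4 ^ (p - 1) = - 2 * int p ^ 3] (mod int p ^ 4)"
    by (simp add: cong_iff_dvd_diff algebra_simps eval_nat_numeral)
  moreover have "int p ^ 4 dvd int p ^ 5"
    by (simp add: le_imp_power_dvd)
  then have "[v_seq (m + 2) = 2 * int p ^ 3 * (1 - int p) * fact (p - 1) * 4 ^ (p - 1)] (mod int p ^ 4)"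
    using v_seq_half_prime cong_dvd_modulus by blast
  ultimately show ?thesis
    using cong_trans by blast
qed

end

end

section \<open>Integrality at p, and powers of 1 - x modulo p\<close>

lemma p_integral_of_int_divide:
  assumes "coprime b (int p)"
  shows "p_integral p (of_int a / of_int b)"
proof (cases "b = 0")
  case False
  have "Rat.Fract a b = of_int a / of_int b"
    by (rule Fract_of_int_quotient)
  then have "quotient_of (of_int a / of_int b) = Rat.normalize (a, b)"
    by (metis quotient_of_Fract)
  \<comment> \<open>The lowest-terms denominator divides any denominator. In the remaining case
    \<open>b = 0\<close> the quotient is 0, whose denominator is 1.\<close>
  then have "snd (quotient_of (of_int a / of_int b)) dvd b"
    using False by (auto simp: Rat.normalize_def Let_def div_dvd_iff_mult)
  then show ?thesis
    using assms unfolding p_integral_def by (meson coprime_divisors dvd_refl)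
qed (simp add: p_integral_def)

text \<open>The copies of \<open>D\<close> shifted by multiples of \<open>k\<close> can overlap only
  at exponents divisible by \<open>k\<close>, so the strict bounds on \<open>m\<close> single out
  the copy shifted by \<open>r * k\<close>. The induction is Pascal's rule.\<close>

lemma coeff_one_minus_monom_power_mult:
  fixes D :: "int poly"
  assumes "degree D \<le> k" "0 < m" "m < k"
  shows "coeff ((1 - monom 1 k) ^ n * D) (r * k + m) = (-1) ^ r * int (n choose r) * coeff D m"
proof (induction n arbitrary: r)
  case 0
  show ?case
    using assms by (cases r) (auto simp: coeff_eq_0)
next
  case (Suc n)
  have "(1 - monom 1 k) ^ Suc n * D = (1 - monom 1 k) ^ n * D - monom 1 k * ((1 - monom 1 k) ^ n * D)"
    by (simp add: algebra_simps)
  then have *: "coeff ((1 - monom 1 k) ^ Suc n * D) j = coeff ((1 - monom 1 k) ^ n * D) j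
      - (if j < k then 0 else coeff ((1 - monom 1 k) ^ n * D) (j - k))" for j
    by (simp only: coeff_diff coeff_monom_mult) simp
  show ?case
  proof (cases r)
    case 0
    then show ?thesis
      using Suc.IH[of 0] assms unfolding * by simp
  next
    case (Suc q)
    then have "r * k + m - k = q * k + m" "\<not> r * k + m < k"
      by auto
    then show ?thesis
      using Suc.IH[of r] Suc.IH[of q] Suc unfolding * by (simp add: algebra_simps)
  qed
qed

lemma one_minus_x_power_prime:
  assumes "prime p" "odd p"
  shows "[:int p:] dvd [:1, -1:] ^ p - (1 - monom 1 p)"
  unfolding const_poly_dvd_iff
proof
  fix k
  have "p > 0"
    using assms prime_gt_0_nat by blast
  consider "k = 0" | "k = p" | "0 < k" "k < p" | "p < k"
    by linarith
  then show "int p dvd coeff ([:1, -1:] ^ p - (1 - monom 1 p)) k"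
  proof cases
    case 3
    then have "p dvd p choose k"
      using assms by (intro dvd_choose_prime) auto
    then show ?thesis
      using 3 by (simp add: coeff_one_minus_x_power)
  qed (use assms \<open>p > 0\<close> in \<open>simp_all add: coeff_one_minus_x_power binomial_eq_0\<close>)
qed

lemma degree_b_poly: "degree (\<Prod>a=1..2 * r. [:2 * int r + 1 - int a, int a:]) \<le> 2 * r"
proof -
  have "degree (\<Prod>a=1..2 * r. [:2 * int r + 1 - int a, int a:])
      \<le> (\<Sum>a=1..2 * r. degree [:2 * int r + 1 - int a, int a:])"
    using degree_prod_sum_le[of "{1..2 * r}" "\<lambda>a. [:2 * int r + 1 - int a, int a:]"] by (simp add: o_def)
  also have "\<dots> \<le> (\<Sum>a=1..2 * r. 1)"
    by (rule sum_mono) simp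
  finally show ?thesis
    by simp
qed

lemma double_poch_of_int: "double_poch (of_int u :: 'a::comm_ring_1) a = of_int (double_poch u a)"
  by (simp add: double_poch_def of_int_prod)

section \<open>The case \<open>N = (2 * r + 1) * p\<close>\<close>

context
  fixes p m :: nat
  assumes prime: "prime p" and p_eq: "p = 2 * m + 1"
begin

text \<open>Passing from \<open>k\<close> to \<open>k + 1\<close> multiplies both sides by (k + s +
  1) / (k + 1) modulo p, since p - (s + 1) - k is congruent to -(k + s + 1). The denominator is
  invertible because it stays below p.\<close>

lemma binomial_prime_minus_cong:
  assumes "Suc s \<le> p" "k < p"
  shows "[fact s * ((-1) ^ k * int (p - Suc s choose k)) = (\<Prod>i=1..s. int k + int i)] (mod int p)"
  using assms(2)
proof (induction k)
  case 0
  show ?case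
    by (simp add: fact_prod of_nat_prod)
next
  case (Suc k)
  let ?n = "p - Suc s"
  have absorb: "int (Suc k) * int (?n choose Suc k) = (int ?n - int k) * int (?n choose k)"
  proof (cases "k \<le> ?n")
    case True
    moreover have "Suc k * (?n choose Suc k) = (?n - k) * (?n choose k)"
      by (simp only: binomial_absorption binomial_absorb_comp)
    then have "int (Suc k) * int (?n choose Suc k) = int (?n - k) * int (?n choose k)"
      by (simp only: flip: of_nat_mult)
    ultimately show ?thesis
      by (simp only: of_nat_diff)
  qed (simp add: binomial_eq_0)
  have "int (Suc k) * (fact s * ((-1) ^ Suc k * int (?n choose Suc k)))
      = fact s * (- ((-1) ^ k)) * (int (Suc k) * int (?n choose Suc k))"
    by (simp add: algebra_simps)
  also have "\<dots> = (int k + int (Suc s) - int p) * (fact s * ((-1) ^ k * int (?n choose k)))"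
    unfolding absorb using assms(1) by (simp add: of_nat_diff algebra_simps)
  also have "[\<dots> = (int k + int (Suc s)) * (\<Prod>i=1..s. int k + int i)] (mod int p)"
    using Suc by (intro cong_mult) (simp_all add: cong_iff_dvd_diff)
  also have "(int k + int (Suc s)) * (\<Prod>i=1..s. int k + int i) = (\<Prod>i=1..Suc s. int k + int i)"
    by simp
  also have "\<dots> = (\<Prod>i=0..s. int k + int (Suc i))"
    by (simp only: One_nat_def prod.shift_bounds_cl_Suc_ivl)
  also have "\<dots> = int (Suc k) * (\<Prod>i=1..s. int (Suc k) + int i)"
    by (simp add: prod.atLeast_Suc_atMost ac_simps)
  finally show ?case
    using coprime_prime_int[OF prime not_dvd_below[OF prime p_eq]] Suc.prems
    by (simp only: cong_mult_lcancel)
qed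

text \<open>Since 2 m is congruent to -1, doubling m - j + i gives 2 i - 1 - 2 j.\<close>

lemma double_poch_cong:
  "[2 ^ s * (\<Prod>i=1..s. (int m - int j) + int i) = double_poch (1 - 2 * int j) s] (mod int p)"
proof -
  have "2 ^ s * (\<Prod>i=1..s. (int m - int j) + int i) = (\<Prod>i=1..s. 2 * ((int m - int j) + int i))"
    by (simp only: prod.distrib prod_constant card_atLeastAtMost diff_Suc_1)
  also have "[\<dots> = (\<Prod>i=1..s. 1 - 2 * int j + 2 * int i - 2)] (mod int p)"
    by (rule cong_prod) (simp add: cong_iff_dvd_diff p_eq add.commute)
  finally show ?thesis
    by (simp add: double_poch_def)
qed

context
  fixes r :: nat
  assumes r_pos: "r \<ge> 1" and r_le: "r \<le> m"
begin

lemma coeff_b_poly_cong: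
  "[2 ^ (2 * r - 1) * fact (2 * r - 1) *
      coeff ((\<Prod>a=1..2 * r. [:2 * int r + 1 - int a, int a:]) * [:1, -1:] ^ (p - 2 * r)) m
    = (\<Sum>j=0..2 * r. b_coeff j r * double_poch (1 - 2 * int j) (2 * r - 1))] (mod int p)"
proof -
  define s where "s = 2 * r - 1"
  have s: "Suc s = 2 * r"
    using r_pos by (simp add: s_def)
  define h where "h = (\<lambda>j. b_coeff j r * double_poch (1 - 2 * int j) s)"
  have b_0: "b_coeff j r = 0" if "j > 2 * r" for j
    unfolding b_coeff_def using that degree_b_poly[of r] by (intro coeff_eq_0) linarith
  have "2 ^ s * fact s * coeff ((\<Prod>a=1..2 * r. [:2 * int r + 1 - int a, int a:]) * [:1, -1:] ^ (p - 2 * r)) m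
      = (\<Sum>j\<le>m. b_coeff j r * (2 ^ s * (fact s * ((-1) ^ (m - j) * int (p - Suc s choose (m - j))))))"
    unfolding coeff_mult b_coeff_def coeff_one_minus_x_power sum_distrib_left s
    by (rule sum.cong) (simp_all only: ac_simps)
  also have "[\<dots> = (\<Sum>j\<le>m. h j)] (mod int p)"
  proof (rule cong_sum)
    fix j assume "j \<in> {..m}"
    then have j: "int (m - j) = int m - int j" "m - j < p"
      using p_eq by auto
    have "[2 ^ s * (fact s * ((-1) ^ (m - j) * int (p - Suc s choose (m - j))))
        = double_poch (1 - 2 * int j) s] (mod int p)"
      using cong_trans[OF cong_scalar_left[OF binomial_prime_minus_cong] double_poch_cong[of s j, folded j(1)]]
        j(2) s r_le p_eq by auto
    then show "[b_coeff j r * (2 ^ s * (fact s * ((-1) ^ (m - j) * int (p - Suc s choose (m - j))))) = h j] (mod int p)"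
      unfolding h_def by (rule cong_scalar_left)
  qed
  \<comment> \<open>The convolution stops at \<open>m\<close>, the target sum at
    \<open>2 * r\<close>, and either may be larger; both are compared with a longer sum. Beyond
    \<open>2 * r\<close> the coefficients vanish.\<close>
  also have "[(\<Sum>j\<le>m. h j) = (\<Sum>j\<le>m + 2 * r. h j)] (mod int p)"
  proof -
    have "{..m + 2 * r} = {..m} \<union> {m<..m + 2 * r}"
      by auto
    then have "(\<Sum>j\<le>m + 2 * r. h j) = (\<Sum>j\<le>m. h j) + (\<Sum>j\<in>{m<..m + 2 * r}. h j)"
      by (simp only:) (rule sum.union_disjoint, auto)
    moreover have "int p dvd (\<Sum>j\<in>{m<..m + 2 * r}. h j)"
    proof (rule dvd_sum)
      fix j assume j: "j \<in> {m<..m + 2 * r}"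
      show "int p dvd h j"
      proof (cases "j \<le> 2 * r")
        \<comment> \<open>For m < j \<le> 2 r the index i = j - m lies in the range of the product
          and gives a zero factor.\<close>
        case True
        then have "j - m \<in> {1..s}" "int m - int j + int (j - m) = 0"
          using j r_pos r_le s by auto
        then have "(\<Prod>i=1..s. (int m - int j) + int i) = 0"
          by (intro prod_zero) auto
        then have "int p dvd double_poch (1 - 2 * int j) s"
          using cong_dvd_iff[OF double_poch_cong[of s j]] by (metis dvd_0_right mult_zero_right)
        then show ?thesis
          by (simp add: h_def)
      qed (simp add: h_def b_0)
    qed
    ultimately show ?thesis
      by (simp add: cong_iff_dvd_diff)
  qed
  also have "(\<Sum>j\<le>m + 2 * r. h j) = (\<Sum>j=0..2 * r. h j)"
    by (rule sum.mono_neutral_right) (auto simp: h_def b_0)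
  finally show ?thesis
    by (simp only: h_def s_def)
qed

text \<open>Modulo p each factor is -i (1 - x), independently of the block \<open>a\<close>. The
  number of factors is even, so the signs cancel, and Wilson turns (p - 1)! into -1.\<close>

lemma block_cong:
  "[:int p:] dvd (\<Prod>i=1..<p. [:int (Suc (2 * r) * p) - int (a * p + i), int (a * p + i):])
    - (- ([:1, -1:] ^ (p - 1)))"
proof (rule dvd_diff_trans)
  show "[:int p:] dvd (\<Prod>i=1..<p. [:int (Suc (2 * r) * p) - int (a * p + i), int (a * p + i):])
    - (\<Prod>i=1..<p. smult (- int i) [:1, -1:])"
    by (rule dvd_diff_prod) (auto simp: const_poly_dvd_iff coeff_pCons algebra_simps split: nat.split)
  have "(\<Prod>i=1..<p. - int i) = (-1) ^ (p - 1) * (\<Prod>i=1..<p. int i)"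
    by (simp add: prod_uminus)
  also have "(\<Prod>i=1..<p. int i) = (\<Prod>i=1..p - 1. int i)"
    using p_eq by (intro prod.cong) auto
  also have "(-1) ^ (p - 1) * (\<Prod>i=1..p - 1. int i) = fact (p - 1)"
    by (simp add: p_eq fact_prod of_nat_prod)
  finally have "(\<Prod>i=1..<p. - int i) = fact (p - 1)" .
  then have "(\<Prod>i=1..<p. smult (- int i) [:1, -1:]) = smult (fact (p - 1)) ([:1, -1:] ^ (p - 1))"
    by (simp only: prod_smult prod_constant card_atLeastLessThan)
  then have "(\<Prod>i=1..<p. smult (- int i) [:1, -1:]) - (- ([:1, -1:] ^ (p - 1)))
      = [:fact (p - 1) + 1:] * [:1, -1:] ^ (p - 1)"
    by (simp add: smult_add_left)
  moreover have "int p dvd fact (p - 1) + 1"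
    using wilson_theorem[OF prime] by (simp add: cong_iff_dvd_diff)
  ultimately show "[:int p:] dvd (\<Prod>i=1..<p. smult (- int i) [:1, -1:]) - (- ([:1, -1:] ^ (p - 1)))"
    by (simp only: const_poly_dvd_const_poly_iff dvd_mult2)
qed

text \<open>\<open>N ^ 2\<close> supplies p^2 and the multiples of p supply p^(2r). As the target
  modulus has only one further factor p, \<open>G\<close> is needed only modulo p.\<close>

lemma v_seq_factor:
  obtains G where
    "v_seq (r * p + m + 2) = (2 * int r + 1) ^ 2 * int p ^ (2 * r + 2) * G"
    "[G = - ((-1) ^ r * int (2 * r choose r) *
        coeff ((\<Prod>a=1..2 * r. [:2 * int r + 1 - int a, int a:]) * [:1, -1:] ^ (p - 2 * r)) m)] (mod int p)"
proof -
  define N where "N = Suc (2 * r) * p"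
  define t :: "int poly" where "t = [:1, -1:]"
  define B where "B = (\<Prod>a=1..2 * r. [:2 * int r + 1 - int a, int a:])"
  define R where "R = (\<Prod>a\<le>2 * r. \<Prod>i=1..<p. [:int N - int (a * p + i), int (a * p + i):])"
  define G where "G = coeff (B * (t * R)) (r * p + m)"
  have p_pos: "p > 0"
    using p_eq by simp
  have "(\<Prod>j=1..<N. [:int N - int j, int j:])
      = (\<Prod>a=1..2 * r. [:int N - int (a * p), int (a * p):]) * R"
    unfolding N_def R_def using p_pos by (rule prod.split_multiples)
  also have "(\<Prod>a=1..2 * r. [:int N - int (a * p), int (a * p):])
      = (\<Prod>a=1..2 * r. smult (int p) [:2 * int r + 1 - int a, int a:])"
    by (rule prod.cong) (simp_all add: N_def algebra_simps)
  also have "\<dots> = smult (int p ^ (2 * r)) B"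
    by (simp only: prod_smult B_def prod_constant card_atLeastAtMost diff_Suc_1)
  finally have "t * (\<Prod>j=1..<N. [:int N - int j, int j:]) = smult (int p ^ (2 * r)) (B * (t * R))"
    by (simp add: ac_simps)
  moreover have "N = 2 * (r * p + m) + 1"
    by (simp add: N_def p_eq algebra_simps)
  ultimately have "v_seq (r * p + m + 2) = int N ^ 2 * (int p ^ (2 * r) * G)"
    using v_seq_odd[of N "r * p + m"] by (simp add: t_def G_def)
  also have "\<dots> = (2 * int r + 1) ^ 2 * int p ^ (2 * r + 2) * G"
    by (simp add: N_def power_mult_distrib power_add power2_eq_square algebra_simps)
  finally have v: "v_seq (r * p + m + 2) = (2 * int r + 1) ^ 2 * int p ^ (2 * r + 2) * G" .
  have "[:int p:] dvd R - (\<Prod>a\<le>2 * r. - (t ^ (p - 1)))"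
    unfolding R_def N_def t_def by (intro dvd_diff_prod block_cong)
  then have "[:int p:] dvd t * R - t * (- (t ^ (p - 1))) ^ Suc (2 * r)"
    by (intro dvd_diff_mult) simp_all
  \<comment> \<open>The exponent 1 + (2r + 1)(p - 1) is regrouped as 2rp + (p - 2r), leaving a
    cofactor whose product with \<open>B\<close> has degree at most p.\<close>
  also have "t * (- (t ^ (p - 1))) ^ Suc (2 * r) = - ((t ^ p) ^ (2 * r) * t ^ (p - 2 * r))"
  proof -
    have "Suc ((p - 1) * Suc (2 * r)) = p * (2 * r) + (p - 2 * r)"
      using r_le by (simp add: p_eq algebra_simps)
    then have "t * (t ^ (p - 1)) ^ Suc (2 * r) = (t ^ p) ^ (2 * r) * t ^ (p - 2 * r)"
      by (simp only: flip: power_mult power_add power_Suc)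
    then show ?thesis
      by (simp add: power_minus_odd)
  qed
  finally have "[:int p:] dvd t * R - (- ((t ^ p) ^ (2 * r) * t ^ (p - 2 * r)))" .
  moreover have "[:int p:] dvd (- ((t ^ p) ^ (2 * r) * t ^ (p - 2 * r)))
      - (- ((1 - monom 1 p) ^ (2 * r) * t ^ (p - 2 * r)))"
  proof -
    have "[:int p:] dvd (t ^ p) ^ (2 * r) * t ^ (p - 2 * r) - (1 - monom 1 p) ^ (2 * r) * t ^ (p - 2 * r)"
      unfolding t_def using prime p_eq
      by (intro dvd_diff_mult dvd_diff_power one_minus_x_power_prime) simp_all
    then show ?thesis
      by (simp only: minus_diff_minus dvd_minus_iff)
  qed
  ultimately have "[:int p:] dvd t * R - (- ((1 - monom 1 p) ^ (2 * r) * t ^ (p - 2 * r)))"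
    by (rule dvd_diff_trans)
  then have "[:int p:] dvd B * (t * R) - B * (- ((1 - monom 1 p) ^ (2 * r) * t ^ (p - 2 * r)))"
    by (intro dvd_diff_mult) simp_all
  from const_dvd_coeff[OF this, of "r * p + m"]
  have "[G = coeff (B * (- ((1 - monom 1 p) ^ (2 * r) * t ^ (p - 2 * r)))) (r * p + m)] (mod int p)"
    by (simp only: G_def cong_iff_dvd_diff)
  also have "B * (- ((1 - monom 1 p) ^ (2 * r) * t ^ (p - 2 * r)))
      = - ((1 - monom 1 p) ^ (2 * r) * (B * t ^ (p - 2 * r)))"
    by (simp add: ac_simps)
  also have "coeff \<dots> (r * p + m) = - ((-1) ^ r * int (2 * r choose r) * coeff (B * t ^ (p - 2 * r)) m)"
  proof -
    have "degree (B * t ^ (p - 2 * r)) \<le> degree B + degree (t ^ (p - 2 * r))"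
      by (rule degree_mult_le)
    also have "\<dots> \<le> 2 * r + (p - 2 * r)"
      using degree_b_poly[of r] degree_power_le[of t "p - 2 * r"]
      by (intro add_mono) (simp_all add: B_def t_def)
    also have "\<dots> = p"
      using r_le p_eq by simp
    finally show ?thesis
      using r_pos r_le p_eq by (simp only: coeff_minus) (subst coeff_one_minus_monom_power_mult, auto)
  qed
  finally show thesis
    using that v by (simp only: B_def t_def)
qed

text \<open>\<open>E\<close> clears the denominators of \<open>C_const r\<close> and is coprime to p
  as r < p. It thus suffices that \<open>E * G\<close> is congruent to \<open>r * S\<close> modulo
  p, which supplies the last factor p.\<close>

lemma v_seq_cong:
  "rat_cong_ppow p (2 * r + 3) (of_int (v_seq (r * p + m + 2))) (C_const r * of_nat p ^ (2 * r + 2))"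
proof -
  define S where "S = (\<Sum>j=0..2 * r. b_coeff j r * double_poch (1 - 2 * int j) (2 * r - 1))"
  define E :: int where "E = (-4) ^ (r - 1) * (fact r) ^ 2"
  define D where "D = coeff ((\<Prod>a=1..2 * r. [:2 * int r + 1 - int a, int a:]) * [:1, -1:] ^ (p - 2 * r)) m"
  have "of_int (double_poch (1 - 2 * int j) (2 * r - 1)) = double_poch (1 - 2 * of_nat j :: rat) (2 * r - 1)" for j
    using double_poch_of_int[of "1 - 2 * int j" "2 * r - 1", where 'a = rat] by simp
  then have C: "C_const r = of_int ((2 * int r + 1) ^ 2 * int r * S) / of_int E"
    by (simp add: C_const_def S_def E_def power_divide)
  have cop: "coprime E (int p)"
  proof -
    have "coprime (int (2 ^ 2)) (int p)"
      using coprime_prime_int[OF prime not_dvd_below[OF prime p_eq], of 2] r_pos r_le p_eq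
      by (simp only: of_nat_power coprime_power_left_iff) simp
    moreover have "coprime (int (fact r)) (int p)"
      using prime r_le p_eq by (intro coprime_prime_int) (simp_all add: prime_dvd_fact_iff)
    ultimately show ?thesis
      by (simp add: E_def)
  qed
  obtain G where v: "v_seq (r * p + m + 2) = (2 * int r + 1) ^ 2 * int p ^ (2 * r + 2) * G"
    and G: "[G = - ((-1) ^ r * int (2 * r choose r) * D)] (mod int p)"
    unfolding D_def by (rule v_seq_factor)
  have "[E * G = E * (- ((-1) ^ r * int (2 * r choose r) * D))] (mod int p)"
    using G by (rule cong_scalar_left)
  \<comment> \<open>The squared factorial in \<open>E\<close> turns \<open>2 * r choose r\<close>
    into (2r)! = 2r (2r - 1)!. The spare 2 and the power of -4 combine to 2^(2r-1), and the signs
    cancel.\<close>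
  also have "E * (- ((-1) ^ r * int (2 * r choose r) * D)) = int r * (2 ^ (2 * r - 1) * fact (2 * r - 1) * D)"
  proof -
    obtain q where q: "r = Suc q"
      using r_pos by (cases r) auto
    have "fact r * fact r * (2 * r choose r) = (fact (2 * r) :: nat)"
      using binomial_fact_lemma[of r "2 * r"] by simp
    then have c: "(fact r) ^ 2 * int (2 * r choose r) = fact (2 * r)"
      unfolding power2_eq_square by (metis of_nat_fact of_nat_mult)
    have sign: "(-4) ^ (r - 1) * (-1) ^ r * 2 = - (2 ^ (2 * r - 1) :: int)"
    proof -
      have "(-4) ^ q * (-1) ^ q = ((-4) * (-1) :: int) ^ q"
        by (rule power_mult_distrib[symmetric])
      moreover have "(2 :: int) ^ (2 * r - 1) = 2 * 4 ^ q"
        by (simp add: q power_mult)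
      ultimately show ?thesis
        by (simp add: q)
    qed
    have "fact (2 * r) = 2 * int r * fact (2 * r - 1)"
      using r_pos fact_reduce[of "2 * r", where 'a = int] by simp
    moreover have "E * (- ((-1) ^ r * int (2 * r choose r) * D))
        = - ((-4) ^ (r - 1) * (-1) ^ r) * ((fact r) ^ 2 * int (2 * r choose r)) * D"
      by (simp add: E_def)
    ultimately have "E * (- ((-1) ^ r * int (2 * r choose r) * D))
        = - ((-4) ^ (r - 1) * (-1) ^ r * 2) * (int r * fact (2 * r - 1)) * D"
      unfolding c by (simp only: mult.assoc mult.left_commute mult_minus_left)
    also have "\<dots> = int r * (2 ^ (2 * r - 1) * fact (2 * r - 1) * D)"
      unfolding sign by (simp add: ac_simps)
    finally show ?thesis .
  qed
  also have "[\<dots> = int r * S] (mod int p)"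
    unfolding D_def S_def by (intro cong_scalar_left coeff_b_poly_cong)
  finally obtain z where "E * G - int r * S = int p * z"
    by (auto simp: cong_iff_dvd_diff elim: dvdE)
  then have z: "of_int E * of_int G - of_nat r * of_int S = (of_nat p * of_int z :: rat)"
    by (metis of_int_diff of_int_mult of_int_of_nat_eq)
  have nz: "(of_int E :: rat) \<noteq> 0" "(of_nat p :: rat) \<noteq> 0"
    using p_eq by (simp_all add: E_def)
  have "of_int (v_seq (r * p + m + 2)) - C_const r * of_nat p ^ (2 * r + 2)
      = (2 * of_nat r + 1) ^ 2 * of_nat p ^ (2 * r + 2)
        * ((of_int E * of_int G - of_nat r * of_int S) / of_int E)"
    using nz unfolding v C by (simp add: field_simps)
  also have "\<dots> = of_nat p ^ (2 * r + 3) * ((2 * of_nat r + 1) ^ 2 * of_int z / of_int E)"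
    unfolding z by (simp add: eval_nat_numeral)
  finally have "(of_int (v_seq (r * p + m + 2)) - C_const r * of_nat p ^ (2 * r + 2)) / of_nat p ^ (2 * r + 3)
      = of_int ((2 * int r + 1) ^ 2 * z) / of_int E"
    using nz by simp
  moreover have "C_const r * of_nat p ^ (2 * r + 2)
      = of_int ((2 * int r + 1) ^ 2 * int r * S * int p ^ (2 * r + 2)) / of_int E"
    unfolding C by simp
  moreover have "p_integral p (of_int (v_seq (r * p + m + 2)))"
    using p_integral_of_int_divide[of 1 p] by simp
  ultimately show ?thesis
    unfolding rat_cong_ppow_def by (simp only: p_integral_of_int_divide[OF cop])
qed

end

end

theorem theorem2:
  shows "(\<forall>p::nat. prime p \<and> p \<ge> 5 \<longrightarrow>
            [v_seq ((p + 3) div 2) = - 2 * int p ^ 3] (mod (int p ^ 4)) \<and>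
            [v_seq ((p + 3) div 2) = 2 * int p ^ 3 * (1 - int p) * fact (p - 1) * 4 ^ (p - 1)]
              (mod (int p ^ 5)))
       \<and> (\<forall>(r::nat) (p::nat). r \<ge> 1 \<and> prime p \<and> p \<ge> 2 * r + 1 \<longrightarrow>
            rat_cong_ppow p (2 * r + 3)
              (of_int (v_seq ((p + 3) div 2 + r * p)))
              (C_const r * of_nat p ^ (2 * r + 2)))"
proof (intro conjI allI impI)
  fix p :: nat
  assume p: "prime p \<and> p \<ge> 5"
  then obtain m where m: "p = 2 * m + 1"
    using prime_odd_nat[of p] by (auto elim!: oddE)
  then have "(p + 3) div 2 = m + 2" "m \<ge> 2"
    using p by auto
  then show "[v_seq ((p + 3) div 2) = - 2 * int p ^ 3] (mod (int p ^ 4))"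
    and "[v_seq ((p + 3) div 2) = 2 * int p ^ 3 * (1 - int p) * fact (p - 1) * 4 ^ (p - 1)] (mod (int p ^ 5))"
    using v_seq_half_prime_leading[of p m] v_seq_half_prime[of p m] p m by simp_all
next
  fix r p :: nat
  assume p: "r \<ge> 1 \<and> prime p \<and> p \<ge> 2 * r + 1"
  then obtain m where m: "p = 2 * m + 1"
    using prime_odd_nat[of p] by (auto elim!: oddE)
  then have eq: "(p + 3) div 2 + r * p = r * p + m + 2" and "r \<le> m"
    using p by auto
  then show "rat_cong_ppow p (2 * r + 3)
              (of_int (v_seq ((p + 3) div 2 + r * p)))
              (C_const r * of_nat p ^ (2 * r + 2))"
    unfolding eq using p m by (intro v_seq_cong) auto
qed

end
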